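(* For $n \geq 4$, the collapsibility number of $\mathcal{VR}(\mathbb{I}_n;3)$ is $8$.
   Context: For $n\ge 1$, $\mathbb{I}_n$ is the $n$-dimensional hypercube graph: vertex set $\{0,1\}^n$, two vertices adjacent iff they differ in exactly one coordinate; it is a metric space with the shortest-path (Hamming) distance $d(v,w)=\#\{i: v(i)\ne w(i)\}$. For a metric space $(X,d)$ and $r\ge0$, $\mathcal{VR}(X;r)$ is the simplicial complex on vertex set $X$ whose simplices are the finite subsets of diameter at most $r$. For a finite simplicial complex $\Delta$: if $\gamma\in\Delta$ with $|\gamma|\le d$ is contained in a unique maximal simplex $\sigma$ of $\Delta$, the elementary $d$-collapse removes all simplices $\tau$ with $\gamma\subseteq\tau\subseteq\sigma$. $\Delta$ is $d$-collapsible if a sequence of elementary $d$-collapses reduces $\Delta$ to the void complex $\emptyset$. The collapsibility number of $\Delta$ is the minimal $d$ such that $\Delta$ is $d$-collapsible. *)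

theory Defs
  imports Main
begin

definition hypercube :: "nat \<Rightarrow> bool list set" where
  "hypercube n = {v. length v = n}"

definition hamming :: "bool list \<Rightarrow> bool list \<Rightarrow> nat" where
  "hamming v w = card {i. i < length v \<and> v ! i \<noteq> w ! i}"

text \<open>Vietoris-Rips complex of the hypercube at scale r: all finite vertex sets
  (including the empty simplex) of diameter at most r.\<close>
definition VR_hypercube :: "nat \<Rightarrow> nat \<Rightarrow> bool list set set" where
  "VR_hypercube n r = {S. S \<subseteq> hypercube n \<and> finite S \<and> (\<forall>v\<in>S. \<forall>w\<in>S. hamming v w \<le> r)}"

definition maximal_simplex :: "'a set set \<Rightarrow> 'a set \<Rightarrow> bool" where
  "maximal_simplex K \<sigma> \<longleftrightarrow> \<sigma> \<in> K \<and> (\<forall>\<tau>\<in>K. \<sigma> \<subseteq> \<tau> \<longrightarrow> \<tau> = \<sigma>)"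

definition elementary_collapse :: "nat \<Rightarrow> 'a set set \<Rightarrow> 'a set set \<Rightarrow> bool" where
  "elementary_collapse d K K' \<longleftrightarrow>
     (\<exists>\<gamma> \<sigma>. \<gamma> \<in> K \<and> card \<gamma> \<le> d \<and> maximal_simplex K \<sigma> \<and> \<gamma> \<subseteq> \<sigma> \<and>
        (\<forall>\<sigma>'. maximal_simplex K \<sigma>' \<and> \<gamma> \<subseteq> \<sigma>' \<longrightarrow> \<sigma>' = \<sigma>) \<and>
        K' = K - {\<tau>. \<gamma> \<subseteq> \<tau> \<and> \<tau> \<subseteq> \<sigma>})"

definition d_collapsible :: "nat \<Rightarrow> 'a set set \<Rightarrow> bool" where
  "d_collapsible d K \<longleftrightarrow> (elementary_collapse d)\<^sup>*\<^sup>* K {}"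

definition collapsibility_number :: "'a set set \<Rightarrow> nat" where
  "collapsibility_number K = (LEAST d. d_collapsible d K)"

end

theory Submission
  imports Defs
begin

text \<open>
  Lower bound: a 4-dimensional subcube spans the boundary complex of the cross-polytope with eight
  antipodal pairs of vertices, and a \<open>d\<close>-collapse with \<open>d < 8\<close> cannot remove any of its faces.

  Upper bound: faces with at most 8 vertices can be deleted one maximal face at a time, so only the
  larger ones matter. Split a face into its vertices of even and of odd weight. Distances within a
  part are 0 or 2, and five vertices at pairwise distance 2 have a common neighbour, which is the
  centre of every larger such set. It follows that a face with four vertices of each parity lies in
  a unique maximal simplex. Once all faces with at least four vertices of each parity are deleted,
  the same holds for faces with five vertices of one parity and \<open>k\<close> of the other, for
  \<open>k = 3, 2, 1, 0\<close> in turn. After these deletions only faces with at most 8 vertices remain.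
\<close>

section \<open>Collapsing along a ranked family of faces\<close>

text \<open>If \<open>\<sigma>\<close> contains every face over \<open>\<gamma>\<close>, it is the
  only maximal simplex over \<open>\<gamma>\<close>, and the interval from \<open>\<gamma>\<close>
  to \<open>\<sigma>\<close> consists of all faces over \<open>\<gamma>\<close>. Collapses thus
  become deletions of all faces over \<open>\<gamma>\<close>.\<close>

lemma elementary_collapse_delete:
  assumes "\<sigma> \<in> K" "\<gamma> \<in> K" "\<gamma> \<subseteq> \<sigma>" "card \<gamma> \<le> d"
    and above: "\<And>\<tau>. \<tau> \<in> K \<Longrightarrow> \<gamma> \<subseteq> \<tau> \<Longrightarrow> \<tau> \<subseteq> \<sigma>"
  shows "elementary_collapse d K {\<tau> \<in> K. \<not> \<gamma> \<subseteq> \<tau>}"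
proof -
  have "maximal_simplex K \<sigma>"
    unfolding maximal_simplex_def using assms by (meson order.trans subset_antisym)
  moreover have "\<forall>\<sigma>'. maximal_simplex K \<sigma>' \<and> \<gamma> \<subseteq> \<sigma>' \<longrightarrow> \<sigma>' = \<sigma>"
    using above \<open>\<sigma> \<in> K\<close> unfolding maximal_simplex_def by metis
  moreover have "{\<tau> \<in> K. \<not> \<gamma> \<subseteq> \<tau>} = K - {\<tau>. \<gamma> \<subseteq> \<tau> \<and> \<tau> \<subseteq> \<sigma>}"
    using above by blast
  ultimately show ?thesis
    unfolding elementary_collapse_def using assms by blast
qed

text \<open>The members of \<open>\<Gamma>\<close> are deleted in increasing rank, ties in any
  order. When the turn of \<open>\<gamma>\<close> comes, its witness \<open>\<sigma>\<close> is
  still present, since it contains no other member of rank at most that of \<open>\<gamma>\<close>,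
  and it contains every surviving face over \<open>\<gamma>\<close>, since such a face contains no
  member of smaller rank.\<close>

lemma ranked_collapse:
  fixes rank :: "'a set \<Rightarrow> nat"
  assumes "finite \<Gamma>"
    and down: "\<And>\<sigma> \<tau>. \<sigma> \<in> K \<Longrightarrow> \<tau> \<subseteq> \<sigma> \<Longrightarrow> \<tau> \<in> K"
    and card: "\<And>\<gamma>. \<gamma> \<in> \<Gamma> \<Longrightarrow> card \<gamma> \<le> d"
    and top: "\<And>\<gamma>. \<gamma> \<in> \<Gamma> \<Longrightarrow> \<exists>\<sigma>\<in>K. \<gamma> \<subseteq> \<sigma> \<and>
        (\<forall>\<gamma>'\<in>\<Gamma>. \<gamma>' \<subseteq> \<sigma> \<longrightarrow> rank \<gamma>' \<le> rank \<gamma> \<longrightarrow> \<gamma>' = \<gamma>) \<and>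
        (\<forall>\<tau>\<in>K. \<gamma> \<subseteq> \<tau> \<longrightarrow> (\<forall>\<gamma>'\<in>\<Gamma>. \<gamma>' \<subseteq> \<tau> \<longrightarrow> rank \<gamma> \<le> rank \<gamma>') \<longrightarrow> \<tau> \<subseteq> \<sigma>)"
  shows "(elementary_collapse d)\<^sup>*\<^sup>* K {\<tau> \<in> K. \<forall>\<gamma>\<in>\<Gamma>. \<not> \<gamma> \<subseteq> \<tau>}"
  using assms(1,3,4)
proof (induction \<Gamma> rule: finite_ranking_induct[where f = rank])
  case empty
  then show ?case by simp
next
  case (insert \<gamma> \<Delta>)
  let ?L = "{\<tau> \<in> K. \<forall>\<delta>\<in>\<Delta>. \<not> \<delta> \<subseteq> \<tau>}"
  have "(elementary_collapse d)\<^sup>*\<^sup>* K ?L"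
  proof (rule insert.IH)
    fix \<delta> assume \<delta>: "\<delta> \<in> \<Delta>"
    then show "card \<delta> \<le> d" using insert.prems(1) by simp
    \<comment> \<open>Passing from \<open>insert \<gamma> \<Delta>\<close> to
      \<open>\<Delta>\<close> weakens the assumption on \<open>\<tau>\<close>, but for
      \<open>\<gamma>\<close> the required rank inequality holds anyway.\<close>
    have le: "rank \<delta> \<le> rank \<gamma>" using insert.hyps(2) \<delta> by simp
    obtain \<sigma> where \<sigma>: "\<sigma> \<in> K" "\<delta> \<subseteq> \<sigma>"
      "\<forall>\<gamma>'\<in>insert \<gamma> \<Delta>. \<gamma>' \<subseteq> \<sigma> \<longrightarrow> rank \<gamma>' \<le> rank \<delta> \<longrightarrow> \<gamma>' = \<delta>"
      "\<forall>\<tau>\<in>K. \<delta> \<subseteq> \<tau> \<longrightarrow> (\<forall>\<gamma>'\<in>insert \<gamma> \<Delta>. \<gamma>' \<subseteq> \<tau> \<longrightarrow> rank \<delta> \<le> rank \<gamma>') \<longrightarrow> \<tau> \<subseteq> \<sigma>"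
      using insert.prems(2)[of \<delta>] \<delta> by auto
    show "\<exists>\<sigma>\<in>K. \<delta> \<subseteq> \<sigma> \<and>
        (\<forall>\<gamma>'\<in>\<Delta>. \<gamma>' \<subseteq> \<sigma> \<longrightarrow> rank \<gamma>' \<le> rank \<delta> \<longrightarrow> \<gamma>' = \<delta>) \<and>
        (\<forall>\<tau>\<in>K. \<delta> \<subseteq> \<tau> \<longrightarrow> (\<forall>\<gamma>'\<in>\<Delta>. \<gamma>' \<subseteq> \<tau> \<longrightarrow> rank \<delta> \<le> rank \<gamma>') \<longrightarrow> \<tau> \<subseteq> \<sigma>)"
      using \<sigma> le by (intro bexI[of _ \<sigma>] conjI) simp_all
  qed
  moreover have "(elementary_collapse d)\<^sup>*\<^sup>* ?L {\<tau> \<in> ?L. \<not> \<gamma> \<subseteq> \<tau>}"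
  \<comment> \<open>The induction rule allows the inserted element to be present already; then
    nothing is left to delete.\<close>
  proof (cases "\<gamma> \<in> \<Delta>")
    case True
    then have "{\<tau> \<in> ?L. \<not> \<gamma> \<subseteq> \<tau>} = ?L" by blast
    then show ?thesis by simp
  next
    case False
    obtain \<sigma> where \<sigma>: "\<sigma> \<in> K" "\<gamma> \<subseteq> \<sigma>"
      and lower: "\<forall>\<gamma>'\<in>insert \<gamma> \<Delta>. \<gamma>' \<subseteq> \<sigma> \<longrightarrow> rank \<gamma>' \<le> rank \<gamma> \<longrightarrow> \<gamma>' = \<gamma>"
      and above: "\<forall>\<tau>\<in>K. \<gamma> \<subseteq> \<tau> \<longrightarrow>
        (\<forall>\<gamma>'\<in>insert \<gamma> \<Delta>. \<gamma>' \<subseteq> \<tau> \<longrightarrow> rank \<gamma> \<le> rank \<gamma>') \<longrightarrow> \<tau> \<subseteq> \<sigma>"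
      using insert.prems(2)[of \<gamma>] by auto
    have "\<not> \<delta> \<subseteq> \<sigma>" if "\<delta> \<in> \<Delta>" for \<delta>
      using lower insert.hyps(2) that False by blast
    then have "\<sigma> \<in> ?L" using \<sigma> by blast
    moreover from this have "\<gamma> \<in> ?L" using \<sigma> down by blast
    moreover have "\<tau> \<subseteq> \<sigma>" if "\<tau> \<in> ?L" "\<gamma> \<subseteq> \<tau>" for \<tau>
      using above that by blast
    ultimately have "elementary_collapse d ?L {\<tau> \<in> ?L. \<not> \<gamma> \<subseteq> \<tau>}"
      using \<sigma>(2) insert.prems(1)[of \<gamma>] by (intro elementary_collapse_delete[of \<sigma>]) simp_all
    then show ?thesis by (rule r_into_rtranclp)
  qed
  moreover have "{\<tau> \<in> ?L. \<not> \<gamma> \<subseteq> \<tau>} = {\<tau> \<in> K. \<forall>\<gamma>\<in>insert \<gamma> \<Delta>. \<not> \<gamma> \<subseteq> \<tau>}"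
    by blast
  ultimately show ?case by simp
qed

text \<open>Faces are deleted in decreasing order of cardinality, so each is maximal at its turn and
  serves as its own \<open>\<sigma>\<close>. The bound on cardinalities keeps the rank
  \<open>d - card \<tau>\<close> from being truncated.\<close>

lemma d_collapsible_if_card_le:
  assumes "finite K"
    and down: "\<And>\<sigma> \<tau>. \<sigma> \<in> K \<Longrightarrow> \<tau> \<subseteq> \<sigma> \<Longrightarrow> \<tau> \<in> K"
    and card: "\<And>\<tau>. \<tau> \<in> K \<Longrightarrow> finite \<tau> \<and> card \<tau> \<le> d"
  shows "d_collapsible d K"
proof -
  have "(elementary_collapse d)\<^sup>*\<^sup>* K {\<tau> \<in> K. \<forall>\<gamma>\<in>K. \<not> \<gamma> \<subseteq> \<tau>}"
  proof (rule ranked_collapse[where rank = "\<lambda>\<tau>. d - card \<tau>"])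
    fix \<gamma> assume \<gamma>: "\<gamma> \<in> K"
    have "\<gamma>' = \<gamma>" if "\<gamma>' \<in> K" "\<gamma>' \<subseteq> \<gamma>" "d - card \<gamma>' \<le> d - card \<gamma>" for \<gamma>'
      using card[OF \<gamma>] card[OF that(1)] that by (intro card_seteq) auto
    moreover have "\<tau> \<subseteq> \<gamma>" if "\<tau> \<in> K" "\<gamma> \<subseteq> \<tau>" "d - card \<gamma> \<le> d - card \<tau>" for \<tau>
    proof -
      have "card \<tau> \<le> card \<gamma>" using card[OF \<gamma>] card[OF that(1)] that(3) by linarith
      then show ?thesis using card_seteq[of \<tau> \<gamma>] card[OF that(1)] that(2) by blast
    qed
    ultimately show "\<exists>\<sigma>\<in>K. \<gamma> \<subseteq> \<sigma> \<and>
        (\<forall>\<gamma>'\<in>K. \<gamma>' \<subseteq> \<sigma> \<longrightarrow> d - card \<gamma>' \<le> d - card \<gamma> \<longrightarrow> \<gamma>' = \<gamma>) \<and>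
        (\<forall>\<tau>\<in>K. \<gamma> \<subseteq> \<tau> \<longrightarrow> (\<forall>\<gamma>'\<in>K. \<gamma>' \<subseteq> \<tau> \<longrightarrow> d - card \<gamma> \<le> d - card \<gamma>') \<longrightarrow> \<tau> \<subseteq> \<sigma>)"
      using \<gamma> by (intro bexI[of _ \<gamma>]) auto
  qed (use assms in auto)
  moreover have "{\<tau> \<in> K. \<forall>\<gamma>\<in>K. \<not> \<gamma> \<subseteq> \<tau>} = {}" by blast
  ultimately show ?thesis unfolding d_collapsible_def by simp
qed

section \<open>Collapsing a two-coloured complex\<close>

text \<open>Any bijection from \<open>G - F\<close> to \<open>F - G\<close> strictly increases
  \<open>f\<close> at each point, and the elements common to both sets cancel.\<close>

lemma sum_less_if_replaced_by_greater:
  fixes f :: "'a \<Rightarrow> nat"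
  assumes "finite F" "finite G" "card F = card G" "F \<noteq> G"
    and greater: "\<And>x g. x \<in> F \<Longrightarrow> x \<notin> G \<Longrightarrow> g \<in> G \<Longrightarrow> f g < f x"
  shows "sum f G < sum f F"
proof -
  have "card (G - F) = card (F - G)"
    using assms(1-3) by (metis Int_commute card_Diff_subset_Int finite_Int)
  then obtain h where h: "bij_betw h (G - F) (F - G)"
    using assms finite_same_card_bij by blast
  have "G - F \<noteq> {}"
    using assms(1-4) by (metis Diff_eq_empty_iff card_subset_eq)
  then have "sum f (G - F) < (\<Sum>g\<in>G - F. f (h g))"
    using assms h by (intro sum_strict_mono) (auto dest: bij_betwE)
  also have "\<dots> = sum f (F - G)"
    using h by (rule sum.reindex_bij_betw)
  finally have "sum f (G - F) < sum f (F - G)" .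
  moreover have "sum f G = sum f (G \<inter> F) + sum f (G - F)" "sum f F = sum f (G \<inter> F) + sum f (F - G)"
    using assms by (metis sum.Int_Diff Int_commute)+
  ultimately show ?thesis by simp
qed

text \<open>Colours are truth values, so that \<open>p\<close> and \<open>\<not> p\<close> name a
  colour and its opposite and every statement can be used with the two exchanged.\<close>

definition part :: "('a \<Rightarrow> bool) \<Rightarrow> bool \<Rightarrow> 'a set \<Rightarrow> 'a set" where
  "part c p \<tau> = {x \<in> \<tau>. c x = p}"

lemma part_mono: "\<sigma> \<subseteq> \<tau> \<Longrightarrow> part c p \<sigma> \<subseteq> part c p \<tau>"
  by (auto simp: part_def)

lemma finite_part: "finite \<tau> \<Longrightarrow> finite (part c p \<tau>)"
  by (simp add: part_def)

lemma card_part_mono: "finite \<tau> \<Longrightarrow> \<sigma> \<subseteq> \<tau> \<Longrightarrow> card (part c p \<sigma>) \<le> card (part c p \<tau>)"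
  by (simp add: card_mono finite_part part_mono)

lemma part_Un: "\<tau> = part c p \<tau> \<union> part c (\<not> p) \<tau>"
  by (auto simp: part_def)

lemma part_Int: "part c p \<tau> \<inter> part c (\<not> p) \<tau> = {}"
  by (auto simp: part_def)

lemma card_part: "finite \<tau> \<Longrightarrow> card \<tau> = card (part c p \<tau>) + card (part c (\<not> p) \<tau>)"
  by (metis card_Un_disjoint finite_part part_Int part_Un)

lemma sum_part: "finite \<tau> \<Longrightarrow> sum f \<tau> = sum f (part c p \<tau>) + sum f (part c (\<not> p) \<tau>)"
  by (metis sum.union_disjoint finite_part part_Int part_Un)

lemma card_part_insert:
  assumes "finite \<tau>" "\<gamma> \<subseteq> \<tau>" "x \<in> \<tau>" "x \<notin> \<gamma>"
  shows "card (part c (c x) \<gamma>) < card (part c (c x) \<tau>)"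
  using assms by (intro psubset_card_mono finite_part) (auto simp: part_def)

text \<open>The faces of colour type exactly (a, b) are deleted in increasing order of the sum of the
  positions of their vertices: a face containing \<open>\<gamma>\<close> survives until then only if each of its
  further vertices comes after all vertices of \<open>\<gamma>\<close> of the same colour.\<close>

lemma colored_collapse:
  assumes "finite K"
    and down: "\<And>\<sigma> \<tau>. \<sigma> \<in> K \<Longrightarrow> \<tau> \<subseteq> \<sigma> \<Longrightarrow> \<tau> \<in> K"
    and fin: "\<And>\<tau>. \<tau> \<in> K \<Longrightarrow> finite \<tau>"
    and "a + b \<le> d"
    and top: "\<And>\<gamma>. \<gamma> \<in> K \<Longrightarrow> card (part c p \<gamma>) = a \<Longrightarrow> card (part c (\<not> p) \<gamma>) = b \<Longrightarrow>
      \<Union>{\<tau> \<in> K. \<gamma> \<subseteq> \<tau>} \<in> K"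
  shows "(elementary_collapse d)\<^sup>*\<^sup>* K
    {\<tau> \<in> K. \<not> (a \<le> card (part c p \<tau>) \<and> b \<le> card (part c (\<not> p) \<tau>))}"
proof -
  have "finite (\<Union>K)" using assms by auto
  \<comment> \<open>The collapse works for any linear order on the vertices; \<open>pos\<close>
    fixes one.\<close>
  then obtain pos :: "'a \<Rightarrow> nat" where pos: "inj_on pos (\<Union>K)"
    using finite_imp_inj_to_nat_seg by metis
  define \<Gamma> where "\<Gamma> = {\<gamma> \<in> K. card (part c p \<gamma>) = a \<and> card (part c (\<not> p) \<gamma>) = b}"
  have type_eq: "card (part c q \<gamma>') = card (part c q \<gamma>)" if "\<gamma> \<in> \<Gamma>" "\<gamma>' \<in> \<Gamma>" for \<gamma> \<gamma>' q
    using that unfolding \<Gamma>_def by (cases "q = p") auto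
  have "(elementary_collapse d)\<^sup>*\<^sup>* K {\<tau> \<in> K. \<forall>\<gamma>\<in>\<Gamma>. \<not> \<gamma> \<subseteq> \<tau>}"
  proof (rule ranked_collapse[where rank = "sum pos"])
    show "finite \<Gamma>" using assms(1) by (simp add: \<Gamma>_def)
    show "card \<gamma> \<le> d" if "\<gamma> \<in> \<Gamma>" for \<gamma>
      using that card_part[of \<gamma> c p] fin assms(4) by (auto simp: \<Gamma>_def)
  next
    fix \<gamma> assume \<gamma>: "\<gamma> \<in> \<Gamma>"
    then have \<gamma>K: "\<gamma> \<in> K" by (simp add: \<Gamma>_def)
    define U where "U = \<Union>{\<tau> \<in> K. \<gamma> \<subseteq> \<tau>}"
    define \<sigma> where "\<sigma> = {x \<in> U. x \<in> \<gamma> \<or> (\<forall>g\<in>\<gamma>. c g = c x \<longrightarrow> pos g < pos x)}"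
    have "U \<in> K" using top \<gamma> unfolding U_def \<Gamma>_def by blast
    moreover have "\<sigma> \<subseteq> U" unfolding \<sigma>_def by blast
    ultimately have "\<sigma> \<in> K" by (rule down)
    have "\<gamma> \<subseteq> \<sigma>" using \<gamma>K unfolding \<sigma>_def U_def by blast
    have "\<gamma>' = \<gamma>" if \<gamma>': "\<gamma>' \<in> \<Gamma>" "\<gamma>' \<subseteq> \<sigma>" "sum pos \<gamma>' \<le> sum pos \<gamma>" for \<gamma>'
    proof -
      have fins: "finite \<gamma>" "finite \<gamma>'" using fin \<gamma> \<gamma>' by (auto simp: \<Gamma>_def)
      \<comment> \<open>Within one colour the two parts have the same size, and by the choice of
        \<open>\<sigma>\<close> each new vertex comes after all old ones.\<close>
      have *: "sum pos (part c q \<gamma>) < sum pos (part c q \<gamma>')" if "part c q \<gamma>' \<noteq> part c q \<gamma>" for q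
      proof -
        have "pos g < pos x"
          if "x \<in> part c q \<gamma>'" "x \<notin> part c q \<gamma>" "g \<in> part c q \<gamma>" for x g
          using that \<gamma>'(2) unfolding part_def \<sigma>_def by blast
        then show ?thesis
          using that sum_less_if_replaced_by_greater[of "part c q \<gamma>'" "part c q \<gamma>" pos]
            finite_part[OF fins(1)] finite_part[OF fins(2)] type_eq[OF \<gamma> \<gamma>'(1)] by blast
      qed
      \<comment> \<open>Neither colour can lower the sum, so a change in one colour would make the
        total of \<open>\<gamma>'\<close> larger than that of \<open>\<gamma>\<close>.\<close>
      have "part c q \<gamma>' = part c q \<gamma>" for q
        using *[of q] *[of "\<not> q"] \<gamma>'(3) sum_part[OF fins(1), of pos c q]
          sum_part[OF fins(2), of pos c q]
        by (cases "part c (\<not> q) \<gamma>' = part c (\<not> q) \<gamma>") auto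
      then show ?thesis by (metis part_Un)
    qed
    moreover have "\<tau> \<subseteq> \<sigma>"
      if \<tau>: "\<tau> \<in> K" "\<gamma> \<subseteq> \<tau>" and low: "\<forall>\<gamma>'\<in>\<Gamma>. \<gamma>' \<subseteq> \<tau> \<longrightarrow> sum pos \<gamma> \<le> sum pos \<gamma>'" for \<tau>
    proof
      fix x assume x: "x \<in> \<tau>"
      have "pos g < pos x" if "x \<notin> \<gamma>" and g: "g \<in> \<gamma>" "c g = c x" for g
      proof (rule ccontr)
        assume "\<not> pos g < pos x"
        moreover have "pos g \<noteq> pos x"
          using pos \<tau> x g that unfolding inj_on_def by blast
        ultimately have less: "pos x < pos g" by simp
        \<comment> \<open>Exchanging \<open>g\<close> for the earlier vertex \<open>x\<close> of the
          same colour keeps the colour type and lowers the sum, so \<open>\<tau>\<close> would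
          already have been deleted.\<close>
        let ?\<gamma>' = "insert x (\<gamma> - {g})"
        have "finite \<gamma>" using fin \<gamma>K by simp
        have card_eq: "card (part c q ?\<gamma>') = card (part c q \<gamma>)" for q
        proof (cases "q = c x")
          case True
          then have "part c q ?\<gamma>' = insert x (part c q \<gamma> - {g})" "x \<notin> part c q \<gamma>" "g \<in> part c q \<gamma>"
            using that by (auto simp: part_def)
          then show ?thesis
            using finite_part[OF \<open>finite \<gamma>\<close>, of c q] card.remove[of "part c q \<gamma>" g] by simp
        next
          case False
          then have "part c q ?\<gamma>' = part c q \<gamma>" using that by (auto simp: part_def)
          then show ?thesis by simp
        qed
        have sub: "?\<gamma>' \<subseteq> \<tau>" using \<tau> x by blast
        then have "?\<gamma>' \<in> \<Gamma>" using down \<tau>(1) \<gamma> card_eq unfolding \<Gamma>_def by blast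
        moreover have "sum pos ?\<gamma>' < sum pos \<gamma>"
          using \<open>finite \<gamma>\<close> that less by (simp add: sum.remove[of \<gamma> g pos])
        ultimately show False using low sub by fastforce
      qed
      then show "x \<in> \<sigma>" using x \<tau> unfolding \<sigma>_def U_def by blast
    qed
    ultimately show "\<exists>\<sigma>\<in>K. \<gamma> \<subseteq> \<sigma> \<and>
        (\<forall>\<gamma>'\<in>\<Gamma>. \<gamma>' \<subseteq> \<sigma> \<longrightarrow> sum pos \<gamma>' \<le> sum pos \<gamma> \<longrightarrow> \<gamma>' = \<gamma>) \<and>
        (\<forall>\<tau>\<in>K. \<gamma> \<subseteq> \<tau> \<longrightarrow> (\<forall>\<gamma>'\<in>\<Gamma>. \<gamma>' \<subseteq> \<tau> \<longrightarrow> sum pos \<gamma> \<le> sum pos \<gamma>') \<longrightarrow> \<tau> \<subseteq> \<sigma>)"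
      using \<open>\<sigma> \<in> K\<close> \<open>\<gamma> \<subseteq> \<sigma>\<close> by blast
  qed (use down in blast)
  moreover have "(\<exists>\<gamma>\<in>\<Gamma>. \<gamma> \<subseteq> \<tau>) \<longleftrightarrow> a \<le> card (part c p \<tau>) \<and> b \<le> card (part c (\<not> p) \<tau>)"
    if \<tau>: "\<tau> \<in> K" for \<tau>
  proof
    assume "\<exists>\<gamma>\<in>\<Gamma>. \<gamma> \<subseteq> \<tau>"
    then show "a \<le> card (part c p \<tau>) \<and> b \<le> card (part c (\<not> p) \<tau>)"
      using card_part_mono[OF fin[OF \<tau>]] unfolding \<Gamma>_def by blast
  next
    assume "a \<le> card (part c p \<tau>) \<and> b \<le> card (part c (\<not> p) \<tau>)"
    then obtain A B where AB: "A \<subseteq> part c p \<tau>" "card A = a" "B \<subseteq> part c (\<not> p) \<tau>" "card B = b"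
      by (metis obtain_subset_with_card_n)
    then have "part c p (A \<union> B) = A" "part c (\<not> p) (A \<union> B) = B" "A \<union> B \<subseteq> \<tau>"
      by (auto simp: part_def)
    moreover from this have "A \<union> B \<in> \<Gamma>" using AB down[OF \<tau>] unfolding \<Gamma>_def by simp
    ultimately show "\<exists>\<gamma>\<in>\<Gamma>. \<gamma> \<subseteq> \<tau>" by blast
  qed
  ultimately show ?thesis by (smt (verit) Collect_cong)
qed

section \<open>Stars in the symmetric-difference metric\<close>

text \<open>Hamming distance in terms of supports. With sets, translation is symmetric difference,
  and a centre can be any finite set, with no length to track.\<close>

definition sdist :: "'a set \<Rightarrow> 'a set \<Rightarrow> nat" where
  "sdist A B = card (sym_diff A B)"

lemma sdist_commute: "sdist A B = sdist B A"
  by (simp add: sdist_def Un_commute)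

lemma sdist_triangle:
  assumes "finite A" "finite B" "finite C"
  shows "sdist A C \<le> sdist A B + sdist B C"
proof -
  have "sdist A C \<le> card (sym_diff A B \<union> sym_diff B C)"
    unfolding sdist_def using assms by (intro card_mono) auto
  also have "\<dots> \<le> sdist A B + sdist B C"
    unfolding sdist_def by (rule card_Un_le)
  finally show ?thesis .
qed

lemma even_sdist:
  assumes "finite A" "finite B"
  shows "even (sdist A B) \<longleftrightarrow> (even (card A) \<longleftrightarrow> even (card B))"
proof -
  have "card (A - B) + card (A \<inter> B) = card A" "card (B - A) + card (A \<inter> B) = card B"
    using assms by (metis card_Int_Diff add.commute Int_commute)+
  moreover have "sdist A B = card (A - B) + card (B - A)"
    unfolding sdist_def using assms by (intro card_Un_disjoint) auto
  ultimately show ?thesis by presburger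
qed

text \<open>Each \<open>s\<close> is \<open>M\<close> with one element toggled. If \<open>A\<close>
  were farther than \<open>r\<close> from \<open>M\<close>, every \<open>s\<close> would have to
  toggle an element of \<open>sym_diff A M\<close> to come closer to \<open>A\<close>, and coming
  within \<open>r\<close> would force this set to have at most \<open>r + 1\<close> elements.
  Distinct members of \<open>S\<close> toggle distinct elements, so \<open>r + 2\<close> of them
  cannot fit.\<close>

lemma sdist_le_center:
  assumes "finite A" "finite M" and S: "r + 2 \<le> card S"
    and star: "\<And>s. s \<in> S \<Longrightarrow> sdist s M = 1"
    and near: "\<And>s. s \<in> S \<Longrightarrow> sdist A s \<le> r"
  shows "sdist A M \<le> r"
proof (rule ccontr)
  assume far: "\<not> sdist A M \<le> r"
  let ?D = "sym_diff A M"
  have fin: "finite ?D" using assms by simp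
  have *: "\<exists>i\<in>?D. sym_diff s M = {i} \<and> card ?D \<le> r + 1" if s: "s \<in> S" for s
  proof -
    obtain i where i: "sym_diff s M = {i}"
      using star[OF s] unfolding sdist_def by (meson card_1_singletonE)
    then have mem: "x \<in> s \<longleftrightarrow> (x \<in> M \<longleftrightarrow> x \<noteq> i)" for x by blast
    show ?thesis
    proof (cases "i \<in> ?D")
      case True
      then have "sym_diff A s = ?D - {i}" by (auto simp: mem)
      then have "card ?D - 1 \<le> r"
        using near[OF s] True fin by (simp add: sdist_def)
      then show ?thesis using i True by auto
    next
      case False
      then have "sym_diff A s = insert i ?D" by (auto simp: mem)
      then have "card ?D < sdist A s"
        using False fin unfolding sdist_def by simp
      then show ?thesis using near[OF s] far by (simp add: sdist_def)
    qed
  qed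
  have "inj_on (\<lambda>s. sym_diff s M) S" by (rule inj_onI) blast
  moreover have "(\<lambda>s. sym_diff s M) ` S \<subseteq> (\<lambda>i. {i}) ` ?D" using * by blast
  ultimately have "card S \<le> card ((\<lambda>i. {i}) ` ?D)"
    using fin by (intro card_inj_on_le) auto
  also have "\<dots> \<le> card ?D" using fin by (rule card_image_le)
  finally have "card S \<le> card ?D" .
  moreover obtain s where "s \<in> S" using S by fastforce
  ultimately show False using * S by fastforce
qed

text \<open>Pairwise intersecting edges form a star or a triangle, and a triangle has only three
  edges. Without a common element, \<open>P\<close>, \<open>Q\<close> and \<open>R\<close> are the
  sides of a triangle that leaves room for no further edge.\<close>

lemma intersecting_pairs_common_element:
  assumes pairs: "\<And>P. P \<in> F \<Longrightarrow> card P = 2"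
    and meet: "\<And>P Q. P \<in> F \<Longrightarrow> Q \<in> F \<Longrightarrow> P \<inter> Q \<noteq> {}"
    and "4 \<le> card F"
  shows "\<exists>a. \<forall>P\<in>F. a \<in> P"
proof (rule ccontr)
  assume none: "\<nexists>a. \<forall>P\<in>F. a \<in> P"
  obtain P where P: "P \<in> F" using assms(3) by fastforce
  then obtain a b where ab: "P = {a, b}" "a \<noteq> b"
    using pairs by (meson card_2_iff)
  obtain Q where Q: "Q \<in> F" "b \<notin> Q" using none by blast
  then obtain c where c: "Q = {a, c}" "a \<noteq> c"
    using pairs[OF Q(1)] meet[OF P Q(1)] ab by (auto simp: card_2_iff)
  obtain R where R: "R \<in> F" "a \<notin> R" using none by blast
  have avoid: "X = {b, c}" if X: "X \<in> F" "a \<notin> X" for X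
  proof -
    have "{b, c} \<subseteq> X" using meet[OF P X(1)] meet[OF Q(1) X(1)] ab c X(2) by blast
    moreover have "card {b, c} = 2" using Q(2) c by auto
    ultimately show ?thesis
      using pairs[OF X(1)] by (metis card.infinite card_subset_eq zero_neq_numeral)
  qed
  \<comment> \<open>A pair through \<open>a\<close> must meet \<open>R = {b, c}\<close>, which makes
    it \<open>P\<close> or \<open>Q\<close>.\<close>
  have "X \<in> {P, Q, R}" if X: "X \<in> F" for X
  proof (cases "a \<in> X")
    case True
    then obtain z where z: "X = {a, z}" using pairs[OF X] by (auto simp: card_2_iff)
    then show ?thesis using meet[OF R(1) X] avoid[OF R] R(2) ab c by blast
  next
    case False
    then show ?thesis using avoid X R by blast
  qed
  then have "card F \<le> card {P, Q, R}" by (intro card_mono) auto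
  also have "\<dots> \<le> 3" by (simp add: card_insert_if)
  finally show False using assms(3) by simp
qed

text \<open>Translating by a member \<open>A\<close> turns the other members into at least four
  pairs. Disjoint pairs would come from sets at distance 4, so the pairs share an element
  \<open>a\<close>, and toggling \<open>a\<close> in \<open>A\<close> gives the centre. Four sets do
  not suffice: the even subsets of a three-element set have no centre.\<close>

lemma equidistant_star:
  assumes "\<And>A. A \<in> F \<Longrightarrow> finite A" "5 \<le> card F"
    and two: "\<And>A B. A \<in> F \<Longrightarrow> B \<in> F \<Longrightarrow> A \<noteq> B \<Longrightarrow> sdist A B = 2"
  shows "\<exists>M. finite M \<and> (\<forall>A\<in>F. sdist A M = 1)"
proof -
  obtain A where A: "A \<in> F" using assms(2) by fastforce
  let ?P = "(\<lambda>X. sym_diff X A) ` (F - {A})"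
  have "inj_on (\<lambda>X. sym_diff X A) (F - {A})" by (rule inj_onI) blast
  then have "4 \<le> card ?P" using A assms(2) by (simp add: card_image)
  moreover have "card P = 2" if "P \<in> ?P" for P
    using that two A unfolding sdist_def by blast
  moreover have "P \<inter> Q \<noteq> {}" if PQ: "P \<in> ?P" "Q \<in> ?P" for P Q
  proof
    assume disj: "P \<inter> Q = {}"
    obtain X Y where XY: "X \<in> F" "Y \<in> F" "P = sym_diff X A" "Q = sym_diff Y A"
      using PQ by blast
    have cards: "card P = 2" "card Q = 2" using PQ two A unfolding sdist_def by blast+
    then have "P \<noteq> Q" using disj by auto
    then have "X \<noteq> Y" using XY by blast
    then have "card (sym_diff X Y) = 2" using two XY unfolding sdist_def by blast
    moreover have "sym_diff X Y = P \<union> Q" using XY disj by blast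
    moreover have "card (P \<union> Q) = 4"
      using cards disj card_Un_disjoint[of P Q] by (metis card.infinite numeral_Bit0 zero_neq_numeral)
    ultimately show False by simp
  qed
  ultimately obtain a where a: "\<forall>P\<in>?P. a \<in> P"
    using intersecting_pairs_common_element[of ?P] by blast
  let ?M = "sym_diff A {a}"
  have "sdist X ?M = 1" if X: "X \<in> F" for X
  proof (cases "X = A")
    case True
    then have "sym_diff X ?M = {a}" by blast
    then show ?thesis by (simp add: sdist_def)
  next
    case False
    then have "sym_diff X A \<in> ?P" using X by (intro imageI) simp
    then have "a \<in> sym_diff X A" using a by (rule bspec[rotated])
    then have "sym_diff X ?M = sym_diff X A - {a}" by auto
    moreover have "card (sym_diff X A) = 2" using two X A False unfolding sdist_def by blast
    ultimately show ?thesis using \<open>a \<in> sym_diff X A\<close> unfolding sdist_def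
      by (metis card_Diff_singleton diff_add_inverse one_add_one)
  qed
  moreover have "finite ?M" using assms(1) A by simp
  ultimately show ?thesis by (intro exI[of _ ?M] conjI ballI)
qed

section \<open>Cliques of one parity in the hypercube\<close>

definition supp :: "bool list \<Rightarrow> nat set" where
  "supp v = {i. i < length v \<and> v ! i}"

definition parity :: "bool list \<Rightarrow> bool" where
  "parity v \<longleftrightarrow> even (card (supp v))"

lemma finite_supp [simp]: "finite (supp v)"
  by (simp add: supp_def)

lemma hamming_eq_sdist:
  assumes "v \<in> hypercube n" "w \<in> hypercube n"
  shows "hamming v w = sdist (supp v) (supp w)"
proof -
  have "{i. i < length v \<and> v ! i \<noteq> w ! i} = sym_diff (supp v) (supp w)"
    using assms by (auto simp: supp_def hypercube_def)
  then show ?thesis by (simp add: hamming_def sdist_def)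
qed

lemma inj_on_supp: "inj_on supp (hypercube n)"
proof (rule inj_onI)
  fix v w assume "v \<in> hypercube n" "w \<in> hypercube n" "supp v = supp w"
  then show "v = w"
    by (intro nth_equalityI) (auto simp: supp_def hypercube_def set_eq_iff)
qed

lemma even_hamming:
  assumes "v \<in> hypercube n" "w \<in> hypercube n"
  shows "even (hamming v w) \<longleftrightarrow> parity v = parity w"
  using even_sdist[of "supp v" "supp w"] hamming_eq_sdist[OF assms] by (simp add: parity_def)

lemma hamming_le_2_if_parity_eq:
  assumes "v \<in> hypercube n" "w \<in> hypercube n" "parity v = parity w" "hamming v w \<le> 3"
  shows "hamming v w \<le> 2"
proof -
  have "hamming v w \<noteq> 3" using even_hamming[OF assms(1,2)] assms(3) by auto
  then show ?thesis using assms(4) by simp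
qed

text \<open>Distinct vertices of equal parity are at an even positive distance, here at most 3,
  hence exactly 2, and the supports form an equidistant family.\<close>

lemma clique_star:
  assumes E: "E \<subseteq> hypercube n" "5 \<le> card E"
    and par: "\<And>x. x \<in> E \<Longrightarrow> parity x = p"
    and diam: "\<And>x y. x \<in> E \<Longrightarrow> y \<in> E \<Longrightarrow> hamming x y \<le> 3"
  shows "\<exists>M. finite M \<and> (\<forall>x\<in>E. sdist (supp x) M = 1)"
proof -
  have "sdist (supp x) (supp y) = 2" if xy: "x \<in> E" "y \<in> E" "supp x \<noteq> supp y" for x y
  proof -
    have cube: "x \<in> hypercube n" "y \<in> hypercube n" using xy E by auto
    have "hamming x y \<le> 2" "even (hamming x y)"
      using hamming_le_2_if_parity_eq[OF cube] even_hamming[OF cube] par diam xy by auto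
    moreover have "sym_diff (supp x) (supp y) \<noteq> {}" using xy(3) by blast
    then have "sdist (supp x) (supp y) \<noteq> 0" unfolding sdist_def by simp
    moreover have "hamming x y \<noteq> 1" using \<open>even (hamming x y)\<close> by auto
    ultimately show ?thesis using hamming_eq_sdist[OF cube] by linarith
  qed
  moreover have "card (supp ` E) = card E"
    using inj_on_subset[OF inj_on_supp E(1)] by (rule card_image)
  ultimately have "\<exists>M. finite M \<and> (\<forall>A\<in>supp ` E. sdist A M = 1)"
    using E(2) by (intro equidistant_star) auto
  then show ?thesis by auto
qed

lemma sdist_le_center_supp:
  assumes "E \<subseteq> hypercube n" "finite A" "finite M" "r + 2 \<le> card E"
    and star: "\<And>e. e \<in> E \<Longrightarrow> sdist (supp e) M = 1"
    and near: "\<And>e. e \<in> E \<Longrightarrow> sdist A (supp e) \<le> r"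
  shows "sdist A M \<le> r"
proof (rule sdist_le_center[where S = "supp ` E"])
  have "card (supp ` E) = card E"
    using inj_on_subset[OF inj_on_supp assms(1)] by (rule card_image)
  then show "r + 2 \<le> card (supp ` E)" using assms(4) by simp
  show "sdist s M = 1" if "s \<in> supp ` E" for s using that star by blast
  show "sdist A s \<le> r" if "s \<in> supp ` E" for s using that near by blast
qed (fact assms)+

text \<open>Equal parity improves the distances from \<open>x\<close> to \<open>E\<close> to at most
  2, for which four leaves suffice to bound the distance from \<open>x\<close> to \<open>M\<close>
  by 2. This distance is odd, like that of the leaves, so it is 1.\<close>

lemma star_absorbs:
  assumes E: "E \<subseteq> hypercube n" "4 \<le> card E" "finite M"
    and star: "\<And>e. e \<in> E \<Longrightarrow> sdist (supp e) M = 1"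
    and par: "\<And>e. e \<in> E \<Longrightarrow> parity e = parity x"
    and x: "x \<in> hypercube n" "\<And>e. e \<in> E \<Longrightarrow> hamming x e \<le> 3"
  shows "sdist (supp x) M = 1"
proof -
  have "sdist (supp x) (supp e) \<le> 2" if "e \<in> E" for e
    using hamming_le_2_if_parity_eq[OF x(1)] hamming_eq_sdist[OF x(1)] x(2) par E(1) that
    by (metis subsetD)
  then have le: "sdist (supp x) M \<le> 2"
    using E(2) by (intro sdist_le_center_supp[OF E(1) _ E(3) _ star]) simp_all
  obtain e where e: "e \<in> E" using E(2) by fastforce
  have "odd (sdist (supp e) M)" using star[OF e] by simp
  then have "odd (sdist (supp x) M)"
    using par[OF e] E(3) by (simp add: even_sdist parity_def)
  then show ?thesis using le by presburger
qed

lemma hamming_star_le: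
  assumes "x \<in> hypercube n" "y \<in> hypercube n" "finite M"
    and "sdist (supp x) M = 1" "sdist (supp y) M = 1"
  shows "hamming x y \<le> 3"
  using sdist_triangle[of "supp x" M "supp y"] assms
  by (simp add: hamming_eq_sdist[OF assms(1,2)] sdist_commute)

section \<open>The 8-collapse of the Vietoris-Rips complex\<close>

lemma finite_hypercube: "finite (hypercube n)"
  using finite_lists_length_eq[of "UNIV :: bool set" n] by (simp add: hypercube_def)

lemma finite_VR_hypercube: "finite (VR_hypercube n r)"
  by (rule finite_subset[of _ "Pow (hypercube n)"]) (auto simp: VR_hypercube_def finite_hypercube)

lemma VR_hypercubeD:
  assumes "\<tau> \<in> VR_hypercube n r"
  shows "finite \<tau>" "\<tau> \<subseteq> hypercube n" "x \<in> \<tau> \<Longrightarrow> y \<in> \<tau> \<Longrightarrow> hamming x y \<le> r"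
  using assms by (auto simp: VR_hypercube_def)

lemma VR_hypercube_down: "\<sigma> \<in> VR_hypercube n r \<Longrightarrow> \<tau> \<subseteq> \<sigma> \<Longrightarrow> \<tau> \<in> VR_hypercube n r"
  by (auto simp: VR_hypercube_def intro: finite_subset)

lemma Union_in_VR_hypercube:
  assumes "\<F> \<subseteq> VR_hypercube n r"
    and "\<And>\<sigma> \<tau> x y. \<sigma> \<in> \<F> \<Longrightarrow> \<tau> \<in> \<F> \<Longrightarrow> x \<in> \<sigma> \<Longrightarrow> y \<in> \<tau> \<Longrightarrow> hamming x y \<le> r"
  shows "\<Union>\<F> \<in> VR_hypercube n r"
proof -
  have "\<Union>\<F> \<subseteq> hypercube n" using assms(1) VR_hypercubeD(2) by blast
  moreover from this have "finite (\<Union>\<F>)" using finite_hypercube by (rule finite_subset)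
  ultimately show ?thesis using assms(2) unfolding VR_hypercube_def by blast
qed

text \<open>Together with the four vertices of \<open>\<gamma>\<close> of its own parity,
  \<open>x\<close> lies on a star with centre \<open>M\<close>, and likewise \<open>y\<close> with
  centre \<open>M'\<close>. For equal parities the star of \<open>x\<close> absorbs
  \<open>y\<close>. For different parities the centres turn out to be at distance at most 1, and the
  path from \<open>x\<close> through \<open>M\<close> and \<open>M'\<close> to \<open>y\<close> has
  length at most 3.\<close>

lemma hamming_le_over_type_4_4:
  assumes \<gamma>: "\<And>q. card (part parity q \<gamma>) = 4"
    and \<tau>: "\<tau> \<in> VR_hypercube n 3" "\<gamma> \<subseteq> \<tau>" "x \<in> \<tau>"
    and \<tau>': "\<tau>' \<in> VR_hypercube n 3" "\<gamma> \<subseteq> \<tau>'" "y \<in> \<tau>'"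
  shows "hamming x y \<le> 3"
proof (cases "x \<in> \<gamma> \<or> y \<in> \<gamma>")
  case True
  then show ?thesis using VR_hypercubeD(3) \<tau> \<tau>' by blast
next
  case False
  let ?E = "\<lambda>z. part parity (parity z) \<gamma>"
  have star: "\<exists>M. finite M \<and> (\<forall>e\<in>insert z (?E z). sdist (supp e) M = 1)" "card (insert z (?E z)) = 5"
    if "\<sigma> \<in> VR_hypercube n 3" "\<gamma> \<subseteq> \<sigma>" "z \<in> \<sigma>" "z \<notin> \<gamma>" for z \<sigma>
  proof -
    have sub: "insert z (?E z) \<subseteq> \<sigma>" using that by (auto simp: part_def)
    have "finite (?E z)" using \<gamma>[of "parity z"] by (metis card.infinite zero_neq_numeral)
    then show card5: "card (insert z (?E z)) = 5" using \<gamma>[of "parity z"] that(4) by (simp add: part_def)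
    show "\<exists>M. finite M \<and> (\<forall>e\<in>insert z (?E z). sdist (supp e) M = 1)"
    proof (rule clique_star[where n = n and p = "parity z"])
      show "insert z (?E z) \<subseteq> hypercube n" using sub VR_hypercubeD(2)[OF that(1)] by (rule order.trans)
      show "5 \<le> card (insert z (?E z))" using card5 by simp
      show "parity e = parity z" if "e \<in> insert z (?E z)" for e using that by (auto simp: part_def)
      show "hamming e f \<le> 3" if "e \<in> insert z (?E z)" "f \<in> insert z (?E z)" for e f
        using VR_hypercubeD(3)[OF \<open>\<sigma> \<in> VR_hypercube n 3\<close>] sub that by blast
    qed
  qed
  obtain M where M: "finite M" "\<And>e. e \<in> insert x (?E x) \<Longrightarrow> sdist (supp e) M = 1"
    using star(1)[OF \<tau>] False by blast
  obtain M' where M': "finite M'" "\<And>e. e \<in> insert y (?E y) \<Longrightarrow> sdist (supp e) M' = 1"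
    using star(1)[OF \<tau>'] False by blast
  have cube: "\<tau> \<subseteq> hypercube n" "\<tau>' \<subseteq> hypercube n" "x \<in> hypercube n" "y \<in> hypercube n"
    using VR_hypercubeD(2) \<tau> \<tau>' by blast+
  have sub: "part parity q \<gamma> \<subseteq> \<tau>" "part parity q \<gamma> \<subseteq> \<tau>'" for q
    using \<tau>(2) \<tau>'(2) by (auto simp: part_def)
  show ?thesis
  proof (cases "parity x = parity y")
    case True
    have "sdist (supp y) M = 1"
    proof (rule star_absorbs[where E = "?E x" and n = n])
      show "?E x \<subseteq> hypercube n" using sub(1) cube(1) by (rule order.trans)
      show "4 \<le> card (?E x)" using \<gamma>[of "parity x"] by simp
      show "sdist (supp e) M = 1" if "e \<in> ?E x" for e using M(2) that by blast
      show "parity e = parity y" if "e \<in> ?E x" for e using True that by (simp add: part_def)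
      show "hamming y e \<le> 3" if "e \<in> ?E x" for e
        using VR_hypercubeD(3)[OF \<tau>'(1,3)] sub(2) that by blast
    qed (use cube M in auto)
    then show ?thesis using hamming_star_le cube M by blast
  next
    case False
    have oddM: "parity x \<longleftrightarrow> odd (card M)" "parity y \<longleftrightarrow> odd (card M')"
      using M(2)[of x] M'(2)[of y] even_sdist[of "supp x" M] even_sdist[of "supp y" M'] M(1) M'(1)
      by (auto simp: parity_def)
    have near: "sdist M (supp z) \<le> 2" if z: "z \<in> ?E y" for z
    proof -
      have "z \<in> \<tau>" using z sub(1) by blast
      have insert_sub: "insert x (?E x) \<subseteq> \<tau>" using sub(1) \<tau>(3) by blast
      have "sdist (supp z) (supp e) \<le> 3" if "e \<in> insert x (?E x)" for e
      proof -
        have "e \<in> \<tau>" using that insert_sub by blast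
        then have "hamming z e \<le> 3" "z \<in> hypercube n" "e \<in> hypercube n"
          using VR_hypercubeD(3)[OF \<tau>(1) \<open>z \<in> \<tau>\<close>] \<open>z \<in> \<tau>\<close> cube(1) by auto
        then show ?thesis using hamming_eq_sdist[of z n e] by simp
      qed
      \<comment> \<open>Radius 3 needs five leaves, so \<open>x\<close> itself is counted along with
        the four vertices in \<open>\<gamma>\<close>. Parity then lowers the bound to 2.\<close>
      then have "sdist (supp z) M \<le> 3"
        using star(2)[OF \<tau>] \<open>\<not> (x \<in> \<gamma> \<or> y \<in> \<gamma>)\<close>
        by (intro sdist_le_center_supp[OF order.trans[OF insert_sub cube(1)] _ M(1) _ M(2)]) simp_all
      moreover have "parity z = parity y" using z by (simp add: part_def)
      then have "even (sdist (supp z) M)"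
        using even_sdist[of "supp z" M] M(1) False oddM by (auto simp: parity_def)
      then have "sdist (supp z) M \<noteq> 3" by auto
      ultimately show ?thesis by (simp add: sdist_commute)
    qed
    \<comment> \<open>Now the centre \<open>M\<close> plays the role of the near point. Radius 2
      needs only the four leaves of \<open>M'\<close> in \<open>\<gamma>\<close>, whose distances to
      the vertices of \<open>\<tau>\<close> are controlled; \<open>y\<close> need not lie in
      \<open>\<tau>\<close>.\<close>
    have "sdist M M' \<le> 2"
      using \<gamma>[of "parity y"] M' near
      by (intro sdist_le_center_supp[OF order.trans[OF sub(1)[of "parity y"] cube(1)] M(1) M'(1)])
        simp_all
    moreover have "odd (sdist M M')" using even_sdist[OF M(1) M'(1)] False oddM by auto
    then have "sdist M M' \<noteq> 2" by auto
    ultimately have "sdist M M' \<le> 1" by simp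
    moreover have "sdist (supp x) M = 1" "sdist (supp y) M' = 1" using M(2) M'(2) by auto
    moreover have "sdist (supp x) (supp y) \<le> sdist (supp x) M + sdist M (supp y)"
      "sdist M (supp y) \<le> sdist M M' + sdist M' (supp y)"
      using M(1) M'(1) by (auto intro: sdist_triangle)
    ultimately show ?thesis
      using hamming_eq_sdist[OF cube(3,4)] by (simp add: sdist_commute)
  qed
qed

text \<open>The stages of the collapse; \<open>thin n p 4 4\<close> is what remains after the faces with at least four
  vertices of each parity are gone.\<close>

definition thin :: "nat \<Rightarrow> bool \<Rightarrow> nat \<Rightarrow> nat \<Rightarrow> bool list set set" where
  "thin n p a b = {\<tau> \<in> VR_hypercube n 3.
    \<not> (4 \<le> card (part parity p \<tau>) \<and> 4 \<le> card (part parity (\<not> p) \<tau>)) \<and>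
    (5 \<le> card (part parity p \<tau>) \<longrightarrow> card (part parity (\<not> p) \<tau>) < a) \<and>
    (5 \<le> card (part parity (\<not> p) \<tau>) \<longrightarrow> card (part parity p \<tau>) < b)}"

text \<open>Lets the reduction of the first bound serve for the second as well.\<close>

lemma thin_swap: "thin n (\<not> p) b a = thin n p a b"
  unfolding thin_def by auto

lemma finite_thin: "finite (thin n p a b)"
  unfolding thin_def using finite_VR_hypercube by simp

lemma thin_down:
  assumes "\<sigma> \<in> thin n p a b" "\<tau> \<subseteq> \<sigma>"
  shows "\<tau> \<in> thin n p a b"
proof -
  have "\<sigma> \<in> VR_hypercube n 3" using assms by (simp add: thin_def)
  then have "card (part parity q \<tau>) \<le> card (part parity q \<sigma>)" for q
    using VR_hypercubeD(1) assms(2) by (intro card_part_mono)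
  from this[of p] this[of "\<not> p"] show ?thesis
    using assms VR_hypercube_down[of \<sigma> n 3 \<tau>] unfolding thin_def by auto
qed

lemma VR_hypercube_collapses_to_thin:
  "(elementary_collapse 8)\<^sup>*\<^sup>* (VR_hypercube n 3) (thin n p 4 4)"
proof -
  have "(elementary_collapse 8)\<^sup>*\<^sup>* (VR_hypercube n 3) {\<tau> \<in> VR_hypercube n 3.
    \<not> (4 \<le> card (part parity p \<tau>) \<and> 4 \<le> card (part parity (\<not> p) \<tau>))}"
  proof (rule colored_collapse)
    fix \<gamma> assume card: "card (part parity p \<gamma>) = 4" "card (part parity (\<not> p) \<gamma>) = 4"
    have "card (part parity q \<gamma>) = 4" for q using card by (cases "q = p") auto
    then show "\<Union>{\<tau> \<in> VR_hypercube n 3. \<gamma> \<subseteq> \<tau>} \<in> VR_hypercube n 3"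
      using hamming_le_over_type_4_4[of \<gamma> _ n] by (intro Union_in_VR_hypercube) auto
  qed (auto simp: finite_VR_hypercube VR_hypercubeD(1) intro: VR_hypercube_down)
  \<comment> \<open>With both bounds equal to 4, the last two clauses of \<open>thin\<close> follow
    from the first.\<close>
  moreover have "{\<tau> \<in> VR_hypercube n 3.
    \<not> (4 \<le> card (part parity p \<tau>) \<and> 4 \<le> card (part parity (\<not> p) \<tau>))} = thin n p 4 4"
    unfolding thin_def by auto
  ultimately show ?thesis by simp
qed

text \<open>Let \<open>\<gamma>\<close> have five vertices of parity \<open>p\<close> and
  \<open>a\<close> of the other. The bound \<open>Suc a\<close> lets faces over
  \<open>\<gamma>\<close> gain only vertices of parity \<open>p\<close>, and the star of the five
  absorbs all of these, so the union of these faces is again a face. From \<open>a \<le> 3\<close>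
  it also follows that \<open>\<gamma>\<close> has at most 8 vertices.\<close>

lemma thin_step:
  assumes "a \<le> 3"
  shows "(elementary_collapse 8)\<^sup>*\<^sup>* (thin n p (Suc a) b) (thin n p a b)"
proof -
  let ?K = "thin n p (Suc a) b"
  have VR: "\<tau> \<in> VR_hypercube n 3" if "\<tau> \<in> ?K" for \<tau>
    using that by (simp add: thin_def)
  have "(elementary_collapse 8)\<^sup>*\<^sup>* ?K {\<tau> \<in> ?K.
    \<not> (5 \<le> card (part parity p \<tau>) \<and> a \<le> card (part parity (\<not> p) \<tau>))}"
  proof (rule colored_collapse)
    fix \<gamma> assume \<gamma>: "\<gamma> \<in> ?K" "card (part parity p \<gamma>) = 5" "card (part parity (\<not> p) \<gamma>) = a"
    let ?E = "part parity p \<gamma>"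
    let ?U = "\<Union>{\<tau> \<in> ?K. \<gamma> \<subseteq> \<tau>}"
    have new: "parity x = p" if "\<tau> \<in> ?K" "\<gamma> \<subseteq> \<tau>" "x \<in> \<tau>" "x \<notin> \<gamma>" for x \<tau>
    proof (rule ccontr)
      assume "parity x \<noteq> p"
      then have "parity x = (\<not> p)" by simp
      have fin: "finite \<tau>" using VR_hypercubeD(1) VR that(1) by blast
      have "a < card (part parity (\<not> p) \<tau>)"
        using card_part_insert[OF fin that(2,3,4), of parity] \<gamma>(3) \<open>parity x = (\<not> p)\<close> by simp
      moreover have "5 \<le> card (part parity p \<tau>)"
        using card_part_mono[OF fin that(2), of parity p] \<gamma>(2) by simp
      ultimately show False using that(1) unfolding thin_def by auto
    qed
    have E: "?E \<subseteq> hypercube n" using VR_hypercubeD(2)[OF VR[OF \<gamma>(1)]] by (auto simp: part_def)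
    have "\<exists>M. finite M \<and> (\<forall>e\<in>?E. sdist (supp e) M = 1)"
      using E \<gamma>(2) VR_hypercubeD(3)[OF VR[OF \<gamma>(1)]]
      by (intro clique_star[where n = n and p = p]) (auto simp: part_def)
    then obtain M where M: "finite M" "\<And>e. e \<in> ?E \<Longrightarrow> sdist (supp e) M = 1" by blast
    have star: "sdist (supp x) M = 1" if x: "\<tau> \<in> ?K" "\<gamma> \<subseteq> \<tau>" "x \<in> \<tau>" "x \<notin> \<gamma>" for x \<tau>
    proof (rule star_absorbs[OF E _ M])
      show "4 \<le> card ?E" using \<gamma>(2) by simp
      show "parity e = parity x" if "e \<in> ?E" for e using that new[OF x] by (simp add: part_def)
      show "x \<in> hypercube n" using VR_hypercubeD(2)[OF VR[OF x(1)]] x(3) by blast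
      show "hamming x e \<le> 3" if "e \<in> ?E" for e
        using VR_hypercubeD(3)[OF VR[OF x(1)] x(3)] that x(2) by (auto simp: part_def)
    qed
    have "hamming x y \<le> 3"
      if "\<tau> \<in> ?K" "\<gamma> \<subseteq> \<tau>" "x \<in> \<tau>" "\<tau>' \<in> ?K" "\<gamma> \<subseteq> \<tau>'" "y \<in> \<tau>'" for \<tau> \<tau>' x y
    proof (cases "x \<in> \<gamma> \<or> y \<in> \<gamma>")
      case True
      then show ?thesis using VR_hypercubeD(3) VR that by blast
    next
      case False
      then show ?thesis
        using star[OF that(1-3)] star[OF that(4-6)] hamming_star_le[of x n y M] M(1)
          VR_hypercubeD(2)[OF VR[OF that(1)]] VR_hypercubeD(2)[OF VR[OF that(4)]] that(3,6) by blast
    qed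
    then have "?U \<in> VR_hypercube n 3"
      using VR by (intro Union_in_VR_hypercube) auto
    moreover have "part parity (\<not> p) ?U = part parity (\<not> p) \<gamma>"
      using new \<gamma>(1) unfolding part_def by blast
    \<comment> \<open>The union still has only \<open>a \<le> 3\<close> vertices of parity
      \<open>\<not> p\<close>, so it violates no clause of \<open>thin\<close>, however many it has
      of parity \<open>p\<close>.\<close>
    ultimately show "?U \<in> ?K" using \<gamma>(3) assms unfolding thin_def by simp
  next
    show "finite \<tau>" if "\<tau> \<in> ?K" for \<tau> using VR[OF that] by (rule VR_hypercubeD(1))
  qed (use assms in \<open>auto simp: finite_thin intro: thin_down\<close>)
  moreover have "{\<tau> \<in> ?K. \<not> (5 \<le> card (part parity p \<tau>) \<and> a \<le> card (part parity (\<not> p) \<tau>))} =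
    thin n p a b"
    unfolding thin_def by auto
  ultimately show ?thesis by simp
qed

lemma thin_collapses:
  "a \<le> 4 \<Longrightarrow> (elementary_collapse 8)\<^sup>*\<^sup>* (thin n p a b) (thin n p 0 b)"
proof (induction a)
  case (Suc a)
  then show ?case using thin_step[of a n p b] by simp
qed simp

lemma VR_hypercube_8_collapsible: "d_collapsible 8 (VR_hypercube n 3)"
proof -
  have "(elementary_collapse 8)\<^sup>*\<^sup>* (VR_hypercube n 3) (thin n True 4 4)"
    by (rule VR_hypercube_collapses_to_thin)
  also have "(elementary_collapse 8)\<^sup>*\<^sup>* (thin n True 4 4) (thin n True 0 4)"
    by (rule thin_collapses) simp
  also have "thin n True 0 4 = thin n False 4 0"
    using thin_swap[of n True 4 0] by simp
  also have "(elementary_collapse 8)\<^sup>*\<^sup>* (thin n False 4 0) (thin n False 0 0)"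
    by (rule thin_collapses) simp
  also have "(elementary_collapse 8)\<^sup>*\<^sup>* (thin n False 0 0) {}"
    unfolding d_collapsible_def[symmetric]
  proof (rule d_collapsible_if_card_le)
    fix \<tau> assume \<tau>: "\<tau> \<in> thin n False 0 0"
    then have "finite \<tau>" using VR_hypercubeD(1) by (auto simp: thin_def)
    \<comment> \<open>A bound of 0 rules out five vertices of the parity concerned, so at most four
      of each remain.\<close>
    then show "finite \<tau> \<and> card \<tau> \<le> 8"
      using \<tau> card_part[of \<tau> parity False] by (auto simp: thin_def)
  qed (auto simp: finite_thin intro: thin_down)
  finally show ?thesis unfolding d_collapsible_def .
qed

section \<open>The lower bound from a cross-polytope\<close>

definition subcube4 :: "nat \<Rightarrow> bool list set" where
  "subcube4 n = (\<lambda>xs. xs @ replicate (n - 4) False) ` {xs. length xs = 4}"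

text \<open>The antipode within the 4-dimensional subcube: the coordinates beyond the fourth stay
  fixed.\<close>

definition antipode :: "bool list \<Rightarrow> bool list" where
  "antipode v = map Not (take 4 v) @ drop 4 v"

text \<open>The boundary complex of the 8-dimensional cross-polytope, a triangulated 7-sphere: a
  face takes at most one vertex from each of the eight antipodal pairs.\<close>

definition cross_polytope :: "nat \<Rightarrow> bool list set set" where
  "cross_polytope n = {S. S \<subseteq> subcube4 n \<and> (\<forall>x\<in>S. antipode x \<notin> S)}"

lemma card_subcube4: "card (subcube4 n) = 16"
proof -
  have "card {xs :: bool list. length xs = 4} = 16"
    using card_lists_length_eq[of "UNIV :: bool set" 4] by simp
  then show ?thesis unfolding subcube4_def by (subst card_image) (auto intro: inj_onI)
qed

lemma subcube4_subset: "4 \<le> n \<Longrightarrow> subcube4 n \<subseteq> hypercube n"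
  by (auto simp: subcube4_def hypercube_def)

lemma antipode_in: "x \<in> subcube4 n \<Longrightarrow> antipode x \<in> subcube4 n"
  by (auto simp: subcube4_def antipode_def)

lemma antipode_antipode: "x \<in> subcube4 n \<Longrightarrow> antipode (antipode x) = x"
  by (auto simp: subcube4_def antipode_def o_def)

lemma hamming_append_same:
  assumes "length xs = length ys"
  shows "hamming (xs @ zs) (ys @ zs) = hamming xs ys"
proof -
  have "{i. i < length (xs @ zs) \<and> (xs @ zs) ! i \<noteq> (ys @ zs) ! i} = {i. i < length xs \<and> xs ! i \<noteq> ys ! i}"
    using assms by (auto simp: nth_append)
  then show ?thesis by (simp add: hamming_def)
qed

lemma hamming_antipode:
  assumes "x \<in> subcube4 n"
  shows "hamming x (antipode x) = 4"
proof -
  obtain xs where xs: "length xs = 4" "x = xs @ replicate (n - 4) False"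
    using assms by (auto simp: subcube4_def)
  then have "hamming x (antipode x) = hamming xs (map Not xs)"
    by (simp add: antipode_def hamming_append_same)
  moreover have "{i. i < length xs \<and> xs ! i \<noteq> map Not xs ! i} = {..<4}"
    using xs(1) by auto
  ultimately show ?thesis by (simp add: hamming_def)
qed

text \<open>Distance above 3 means that all four free coordinates differ, which determines
  \<open>y\<close>.\<close>

lemma hamming_le_3_if_not_antipode:
  assumes "x \<in> subcube4 n" "y \<in> subcube4 n" "y \<noteq> antipode x"
  shows "hamming x y \<le> 3"
proof (rule ccontr)
  assume "\<not> hamming x y \<le> 3"
  obtain xs ys where xs: "length xs = 4" "x = xs @ replicate (n - 4) False"
    and ys: "length ys = 4" "y = ys @ replicate (n - 4) False"
    using assms by (auto simp: subcube4_def)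
  let ?D = "{i. i < length xs \<and> xs ! i \<noteq> ys ! i}"
  have "hamming x y = card ?D"
    unfolding xs(2) ys(2) using xs(1) ys(1) by (subst hamming_append_same) (simp_all add: hamming_def)
  then have "4 \<le> card ?D" using \<open>\<not> hamming x y \<le> 3\<close> by simp
  then have "?D = {..<4}" using xs(1) by (intro card_seteq) auto
  then have "ys = map Not xs" using xs(1) ys(1) by (intro nth_equalityI) auto
  then show False using assms(3) xs ys by (simp add: antipode_def)
qed

lemma cross_polytope_subset_VR:
  assumes "4 \<le> n"
  shows "cross_polytope n \<subseteq> VR_hypercube n 3"
proof
  fix S assume S: "S \<in> cross_polytope n"
  then have "S \<subseteq> hypercube n" using subcube4_subset[OF assms] by (auto simp: cross_polytope_def)
  moreover from this have "finite S" using finite_hypercube by (rule finite_subset)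
  moreover have "hamming x y \<le> 3" if "x \<in> S" "y \<in> S" for x y
    using S that by (intro hamming_le_3_if_not_antipode) (auto simp: cross_polytope_def)
  ultimately show "S \<in> VR_hypercube n 3" by (auto simp: VR_hypercube_def)
qed

text \<open>If every pair were met, \<open>\<gamma>\<close> and its antipodal image would cover all
  16 vertices, but together they have at most 14.\<close>

lemma missed_antipodal_pair:
  assumes "finite \<gamma>" "card \<gamma> < 8"
  shows "\<exists>x\<in>subcube4 n. x \<notin> \<gamma> \<and> antipode x \<notin> \<gamma>"
proof (rule ccontr)
  assume none: "\<not> ?thesis"
  have "subcube4 n \<subseteq> \<gamma> \<union> antipode ` \<gamma>"
  proof
    fix x assume x: "x \<in> subcube4 n"
    show "x \<in> \<gamma> \<union> antipode ` \<gamma>"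
    proof (cases "x \<in> \<gamma>")
      case False
      then have "antipode x \<in> \<gamma>" using none x by blast
      then show ?thesis using antipode_antipode[OF x] by (metis UnI2 imageI)
    qed simp
  qed
  then have "16 \<le> card (\<gamma> \<union> antipode ` \<gamma>)"
    using card_mono[of "\<gamma> \<union> antipode ` \<gamma>" "subcube4 n"] assms(1) card_subcube4 by simp
  also have "\<dots> \<le> card \<gamma> + card (antipode ` \<gamma>)" by (rule card_Un_le)
  also have "\<dots> \<le> card \<gamma> + card \<gamma>" using assms(1) by (simp add: card_image_le)
  finally show False using assms(2) by simp
qed

lemma exists_maximal_simplex:
  assumes "finite K" "\<tau> \<in> K"
  shows "\<exists>\<sigma>. maximal_simplex K \<sigma> \<and> \<tau> \<subseteq> \<sigma>"
  using finite_has_maximal2[OF assms] unfolding maximal_simplex_def by (metis)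

text \<open>A face \<open>\<gamma>\<close> with fewer than 8 vertices extends within the cross-polytope by either vertex of
  some antipodal pair, so it does not lie in a unique maximal simplex.\<close>

lemma elementary_collapse_preserves_cross_polytope:
  assumes "elementary_collapse d K K'" "d < 8" "K \<subseteq> VR_hypercube n 3" "cross_polytope n \<subseteq> K"
  shows "cross_polytope n \<subseteq> K'"
proof
  fix \<tau> assume \<tau>: "\<tau> \<in> cross_polytope n"
  obtain \<gamma> \<sigma> where \<gamma>: "\<gamma> \<in> K" "card \<gamma> \<le> d"
    and \<sigma>: "maximal_simplex K \<sigma>" "\<forall>\<sigma>'. maximal_simplex K \<sigma>' \<and> \<gamma> \<subseteq> \<sigma>' \<longrightarrow> \<sigma>' = \<sigma>"
    and K': "K' = K - {\<tau>. \<gamma> \<subseteq> \<tau> \<and> \<tau> \<subseteq> \<sigma>}"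
    using assms(1) unfolding elementary_collapse_def by auto
  have "\<not> \<gamma> \<subseteq> \<tau>"
  proof
    assume "\<gamma> \<subseteq> \<tau>"
    then have \<gamma>cross: "\<gamma> \<in> cross_polytope n" using \<tau> unfolding cross_polytope_def by blast
    have "finite \<gamma>" using \<gamma>(1) assms(3) VR_hypercubeD(1) by blast
    then obtain x where x: "x \<in> subcube4 n" "x \<notin> \<gamma>" "antipode x \<notin> \<gamma>"
      using missed_antipodal_pair[of \<gamma> n] \<gamma>(2) assms(2) by auto
    \<comment> \<open>Adding \<open>y\<close> gives another face of the cross-polytope; a maximal
      simplex over it also contains \<open>\<gamma>\<close> and hence is \<open>\<sigma>\<close>.
      Applied to both vertices of the missed pair, this puts two vertices at distance 4 into
      \<open>\<sigma>\<close>.\<close>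
    have "y \<in> \<sigma>" if y: "y \<in> subcube4 n" "y \<notin> \<gamma>" "antipode y \<notin> \<gamma>" for y
    proof -
      have "antipode y \<noteq> y" using hamming_antipode[OF y(1)] by (auto simp: hamming_def)
      moreover have "antipode z \<noteq> y" if "z \<in> \<gamma>" for z
        using that y(3) antipode_antipode[of z n] \<gamma>cross by (auto simp: cross_polytope_def)
      ultimately have "insert y \<gamma> \<in> cross_polytope n"
        using \<gamma>cross y by (auto simp: cross_polytope_def)
      then obtain \<sigma>' where "maximal_simplex K \<sigma>'" "insert y \<gamma> \<subseteq> \<sigma>'"
        using exists_maximal_simplex[of K] assms(3,4) finite_VR_hypercube by (meson finite_subset subsetD)
      then show ?thesis using \<sigma>(2) by blast
    qed
    from this[of x] this[of "antipode x"] have "x \<in> \<sigma>" "antipode x \<in> \<sigma>"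
      using x antipode_in[OF x(1)] antipode_antipode[OF x(1)] by auto
    moreover have "\<sigma> \<in> VR_hypercube n 3" using \<sigma>(1) assms(3) by (auto simp: maximal_simplex_def)
    ultimately have "hamming x (antipode x) \<le> 3" using VR_hypercubeD(3) by blast
    then show False using hamming_antipode[OF x(1)] by simp
  qed
  then show "\<tau> \<in> K'" using \<tau> assms(4) K' by blast
qed

text \<open>Every complex reached contains the whole cross-polytope, in particular the empty
  simplex, so the void complex is never reached.\<close>

lemma VR_hypercube_not_collapsible:
  assumes "4 \<le> n" "d < 8"
  shows "\<not> d_collapsible d (VR_hypercube n 3)"
proof
  have "K' \<subseteq> VR_hypercube n 3 \<and> cross_polytope n \<subseteq> K'"
    if "(elementary_collapse d)\<^sup>*\<^sup>* (VR_hypercube n 3) K'" for K'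
    using that
  proof (induction rule: rtranclp_induct)
    case base
    show ?case using cross_polytope_subset_VR[OF assms(1)] by simp
  next
    case (step K K')
    then have "cross_polytope n \<subseteq> K'"
      using elementary_collapse_preserves_cross_polytope assms(2) by blast
    moreover have "K' \<subseteq> K" using step.hyps(2) by (auto simp: elementary_collapse_def)
    ultimately show ?case using step.IH by blast
  qed
  moreover assume "d_collapsible d (VR_hypercube n 3)"
  ultimately have "cross_polytope n \<subseteq> {}" unfolding d_collapsible_def by blast
  moreover have "{} \<in> cross_polytope n" by (simp add: cross_polytope_def)
  ultimately show False by blast
qed

theorem theorem1p6:
  fixes n :: nat
  assumes "n \<ge> 4"
  shows "collapsibility_number (VR_hypercube n 3) = 8"
  unfolding collapsibility_number_def
  using VR_hypercube_8_collapsible VR_hypercube_not_collapsible[OF assms]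
  by (intro Least_equality) (auto simp: not_less[symmetric])

end
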